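(* Let $d,K\ge 1$ be integers and let $E(\boldsymbol{\phi})=E(\phi_1,\dots,\phi_K)$ be a differentiable real-valued cost function of $K$ pure states in $\mathbb{C}^d$, independent of the global phase of each state, written as $E(\boldsymbol{\phi})=\mathcal{E}(|\phi_1\rangle\langle\phi_1|,\dots,|\phi_K\rangle\langle\phi_K|)$ with $\mathcal{E}$ differentiable. Let $\boldsymbol{\phi}(t)=(|\phi_1(t)\rangle,\dots,|\phi_K(t)\rangle)$ be unit vectors solving the multi-state nonlinear imaginary-time evolution (NITE) equations $$\frac{d}{dt}|\phi_k(t)\rangle=-\left(H_k(\boldsymbol{\phi})-\langle\phi_k|H_k(\boldsymbol{\phi})|\phi_k\rangle\right)|\phi_k\rangle,\qquad k=1,\dots,K,$$ where $H_k(\boldsymbol{\phi})$ is the Hilbert--Schmidt gradient of $\mathcal{E}$ with respect to its $k$-th argument at $(|\phi_1\rangle\langle\phi_1|,\dots,|\phi_K\rangle\langle\phi_K|)$. Then $E(\boldsymbol{\phi}(t))$ is monotonically decreasing (non-increasing) in $t$.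
   Context: Let $\mathcal{H}_d$ be the real vector space of $d\times d$ Hermitian matrices with inner product $\langle X,Y\rangle_{HS}=\operatorname{Tr}(XY)$. For a differentiable function $\mathcal{E}$ of $(\rho_1,\dots,\rho_K)\in\mathcal{H}_d^K$, the Hilbert--Schmidt gradient $\nabla^{(\mathrm{HS})}_{\rho_k}\mathcal{E}(\boldsymbol{\rho})\in\mathcal{H}_d$ is the unique element such that the directional derivative of $\mathcal{E}$ in its $k$-th argument in direction $X$ equals $\operatorname{Tr}\big(\nabla^{(\mathrm{HS})}_{\rho_k}\mathcal{E}(\boldsymbol{\rho})\,X\big)$ for all $X\in\mathcal{H}_d$. The single-state NITE is the case $K=1$. *)

theory Defs
  imports "HOL-Analysis.Analysis"
begin

definition adjoint_mat :: "complex^'n^'m \<Rightarrow> complex^'m^'n" where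
  "adjoint_mat A = (\<chi> i j. cnj (A $ j $ i))"

definition hermitian :: "complex^'n^'n \<Rightarrow> bool" where
  "hermitian A \<longleftrightarrow> adjoint_mat A = A"

definition hermitian_tuples :: "(complex^'n^'n^'k) set" where
  "hermitian_tuples = {\<rho>. \<forall>k. hermitian (\<rho> $ k)}"

(* conjugate-linear in the first argument; the library inner product on complex^'n is
   the real part of this *)
definition braket :: "complex^'n \<Rightarrow> complex^'n \<Rightarrow> complex" where
  "braket u v = (\<Sum>i\<in>UNIV. cnj (u $ i) * v $ i)"

definition ketbra :: "complex^'n \<Rightarrow> complex^'n^'n" where
  "ketbra v = (\<chi> i j. v $ i * cnj (v $ j))"

definition pure_states :: "(complex^'n^'k) set" where
  "pure_states = {\<phi>. \<forall>k. norm (\<phi> $ k) = 1}"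

definition density_tuple :: "complex^'n^'k \<Rightarrow> complex^'n^'n^'k" where
  "density_tuple \<phi> = (\<chi> k. ketbra (\<phi> $ k))"

definition shift_at :: "complex^'n^'n^'k \<Rightarrow> 'k \<Rightarrow> complex^'n^'n \<Rightarrow> complex^'n^'n^'k" where
  "shift_at \<rho> k Y = (\<chi> j. if j = k then \<rho> $ j + Y else \<rho> $ j)"

(* The trace is complex-valued, so the directional derivative is taken of the real-valued
   function viewed as a complex-valued function of a real parameter. *)
definition is_hs_gradient ::
  "(complex^'n^'n^'k \<Rightarrow> real) \<Rightarrow> complex^'n^'n^'k \<Rightarrow> 'k \<Rightarrow> complex^'n^'n \<Rightarrow> bool" where
  "is_hs_gradient \<E> \<rho> k G \<longleftrightarrow> hermitian G \<and>
     (\<forall>X. hermitian X \<longrightarrow>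
        ((\<lambda>s. complex_of_real (\<E> (shift_at \<rho> k (s *\<^sub>R X))))
           has_vector_derivative trace (G ** X)) (at 0))"

definition hs_gradient ::
  "(complex^'n^'n^'k \<Rightarrow> real) \<Rightarrow> complex^'n^'n^'k \<Rightarrow> 'k \<Rightarrow> complex^'n^'n" where
  "hs_gradient \<E> \<rho> k = (THE G. is_hs_gradient \<E> \<rho> k G)"

definition nite_hamiltonian ::
  "(complex^'n^'n^'k \<Rightarrow> real) \<Rightarrow> complex^'n^'k \<Rightarrow> 'k \<Rightarrow> complex^'n^'n" where
  "nite_hamiltonian \<E> \<phi> k = hs_gradient \<E> (density_tuple \<phi>) k"

(* At an endpoint of T belonging to T the time derivative is one-sided. *)
definition solves_nite ::
  "(complex^'n^'n^'k \<Rightarrow> real) \<Rightarrow> real set \<Rightarrow> (real \<Rightarrow> complex^'n^'k) \<Rightarrow> bool" where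
  "solves_nite \<E> T \<phi> \<longleftrightarrow>
     (\<forall>t\<in>T. \<forall>k. ((\<lambda>s. \<phi> s $ k) has_vector_derivative
        - ((nite_hamiltonian \<E> (\<phi> t) k
              - mat (braket (\<phi> t $ k) (nite_hamiltonian \<E> (\<phi> t) k *v (\<phi> t $ k))))
            *v (\<phi> t $ k))) (at t within T))"

end

theory Submission
  imports Defs
begin

text \<open>Along a solution, the chain rule gives
  \<open>dE/dt = \<Sum>\<^sub>k \<langle>H\<^sub>k, d\<rho>\<^sub>k/dt\<rangle> = 2 \<Sum>\<^sub>k Re \<langle>H\<^sub>k \<phi>\<^sub>k, d\<phi>\<^sub>k/dt\<rangle> = -2 \<Sum>\<^sub>k (\<parallel>H\<^sub>k \<phi>\<^sub>k\<parallel>\<^sup>2 - \<langle>H\<^sub>k\<rangle>\<^sup>2)\<close>,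
  and each variance in the last sum is nonnegative by Cauchy-Schwarz.\<close>

text \<open>Each basis vector has the form \<open>axis i u\<close>, so pairing with it reads a
  single coordinate. This assembles the velocity of a tuple of density matrices from the velocities
  of its components.\<close>

lemma has_vector_derivative_vec:
  fixes f :: "real \<Rightarrow> 'a::euclidean_space ^ 'm"
  assumes "\<And>i. ((\<lambda>x. f x $ i) has_vector_derivative f' $ i) (at t within S)"
  shows "(f has_vector_derivative f') (at t within S)"
  unfolding has_vector_derivative_def
proof (subst has_derivative_componentwise_within, intro ballI)
  fix b :: "'a^'m" assume "b \<in> Basis"
  then obtain i u where b: "b = axis i u" "u \<in> Basis"
    by (auto simp: Basis_vec_def)
  have "((\<lambda>x. f x $ i \<bullet> u) has_derivative (\<lambda>h. (h *\<^sub>R f' $ i) \<bullet> u)) (at t within S)"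
    by (rule has_derivative_inner_left)
      (use assms[of i] in \<open>simp add: has_vector_derivative_def\<close>)
  then show "((\<lambda>x. f x \<bullet> b) has_derivative (\<lambda>h. (h *\<^sub>R f') \<bullet> b)) (at t within S)"
    by (simp add: b inner_axis)
qed

section \<open>Hermitian matrices and the real inner product\<close>

lemma linear_adjoint_mat: "linear adjoint_mat"
  by (rule linearI) (simp_all add: adjoint_mat_def vec_eq_iff)

lemma adjoint_mat_involution [simp]: "adjoint_mat (adjoint_mat A) = A"
  by (simp add: adjoint_mat_def vec_eq_iff)

lemma inner_adjoint_mat: "adjoint_mat A \<bullet> adjoint_mat B = A \<bullet> B"
proof -
  have "adjoint_mat A \<bullet> adjoint_mat B = (\<Sum>i\<in>UNIV. \<Sum>j\<in>UNIV. A $ j $ i \<bullet> B $ j $ i)"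
    by (simp add: inner_vec_def adjoint_mat_def inner_complex_def)
  also have "\<dots> = A \<bullet> B"
    by (subst sum.swap) (simp add: inner_vec_def)
  finally show ?thesis .
qed

lemma hermitian_nth: "hermitian A \<Longrightarrow> A $ j $ i = cnj (A $ i $ j)"
  unfolding hermitian_def adjoint_mat_def vec_eq_iff by (metis vec_lambda_beta)

lemma hermitian_0: "hermitian 0"
  by (simp add: hermitian_def linear_0[OF linear_adjoint_mat])

lemma hermitian_add: "hermitian A \<Longrightarrow> hermitian B \<Longrightarrow> hermitian (A + B)"
  by (simp add: hermitian_def linear_add[OF linear_adjoint_mat])

lemma hermitian_diff: "hermitian A \<Longrightarrow> hermitian B \<Longrightarrow> hermitian (A - B)"
  by (simp add: hermitian_def linear_diff[OF linear_adjoint_mat])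

lemma hermitian_scaleR: "hermitian A \<Longrightarrow> hermitian (r *\<^sub>R A)"
  by (simp add: hermitian_def linear_scale[OF linear_adjoint_mat])

lemma hermitian_add_adjoint: "hermitian (A + adjoint_mat A)"
  by (simp add: hermitian_def linear_add[OF linear_adjoint_mat] add.commute)

text \<open>Bridge from the complex trace in \<open>is_hs_gradient\<close> to the real inner product
  of the library: \<open>X $ j $ i\<close> is the conjugate of \<open>X $ i $ j\<close>, which
  matches the real parts termwise, and the trace equals its own conjugate after the two sums are
  swapped.\<close>

lemma trace_mult_hermitian:
  assumes "hermitian G" "hermitian X"
  shows "trace (G ** X) = of_real (G \<bullet> X)"
proof (rule complex_eqI)
  have tr: "trace (G ** X) = (\<Sum>i\<in>UNIV. \<Sum>j\<in>UNIV. G $ i $ j * X $ j $ i)"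
    by (simp add: trace_def matrix_matrix_mult_def)
  have "G $ i $ j \<bullet> X $ i $ j = Re (G $ i $ j * X $ j $ i)" for i j
    by (simp add: hermitian_nth[OF assms(2), of j i] inner_complex_def)
  then show "Re (trace (G ** X)) = Re (of_real (G \<bullet> X))"
    by (simp add: tr inner_vec_def Re_sum)
  have "cnj (trace (G ** X)) = (\<Sum>i\<in>UNIV. \<Sum>j\<in>UNIV. G $ j $ i * X $ i $ j)"
    by (simp add: tr cnj_sum flip: hermitian_nth[OF assms(1)] hermitian_nth[OF assms(2)])
  also have "\<dots> = trace (G ** X)"
    unfolding tr by (rule sum.swap)
  finally show "Im (trace (G ** X)) = Im (of_real (G \<bullet> X))"
    by (simp add: complex_eq_iff)
qed

section \<open>Existence and uniqueness of the Hilbert-Schmidt gradient\<close>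

text \<open>The difference \<open>G - G'\<close> is itself an admissible test direction, and testing
  with it forces its squared norm to vanish.\<close>

lemma is_hs_gradient_unique:
  assumes "is_hs_gradient \<E> \<rho> k G" "is_hs_gradient \<E> \<rho> k G'"
  shows "G = G'"
proof -
  have herm: "hermitian G" "hermitian G'"
    using assms by (auto simp: is_hs_gradient_def)
  then have X: "hermitian (G - G')"
    by (rule hermitian_diff)
  have "trace (G ** (G - G')) = trace (G' ** (G - G'))"
    using assms X unfolding is_hs_gradient_def by (blast intro: vector_derivative_unique_at)
  then have "G \<bullet> (G - G') = G' \<bullet> (G - G')"
    using herm X by (simp add: trace_mult_hermitian)
  then have "(G - G') \<bullet> (G - G') = 0"
    by (simp add: inner_diff_left)
  then show ?thesis
    by simp
qed

lemma shift_at_axis: "shift_at \<rho> k Y = \<rho> + axis k Y"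
  by (auto simp: shift_at_def axis_def vec_eq_iff)

lemma linear_axis: "linear (axis k :: 'a::real_vector \<Rightarrow> 'a^'k)"
  by (rule linearI) (simp_all add: axis_def vec_eq_iff)

text \<open>\<open>hs_gradient\<close> is a definite description, so a witness is needed before
  anything can be read off from it. The witness built here also ties the partial gradients to the
  one total derivative \<open>D\<close> that the chain rule uses.\<close>

lemma hs_gradient_represents_derivative:
  fixes \<E> :: "complex^'n^'n^'k \<Rightarrow> real"
  assumes D: "(\<E> has_derivative D) (at \<rho> within hermitian_tuples)"
    and \<rho>: "\<rho> \<in> hermitian_tuples"
  shows "hermitian (hs_gradient \<E> \<rho> k)"
    and "hermitian X \<Longrightarrow> D (axis k X) = hs_gradient \<E> \<rho> k \<bullet> X"
proof -
  \<comment> \<open>Symmetrising the argument extends the functional from Hermitian matrices to all matrices, where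
    Riesz representation applies; the representing matrix inherits the symmetry.\<close>
  define f where "f X = D (axis k ((1/2) *\<^sub>R (X + adjoint_mat X)))" for X
  \<comment> \<open>Since \<open>f\<close> is real-valued, its adjoint at \<open>1\<close> is the
    Riesz vector: \<open>adjoint f 1 \<bullet> X = 1 * f X\<close>.\<close>
  define G where "G = adjoint f 1"
  have D_lin: "linear D"
    using D by (rule has_derivative_linear)
  have "linear (\<lambda>X::complex^'n^'n. (1/2) *\<^sub>R (X + adjoint_mat X))"
    by (intro linear_compose_scale_right linear_compose_add linear_adjoint_mat linear_ident)
  then have f_lin: "linear f"
    unfolding f_def
    by (intro linear_compose[unfolded o_def, OF _ D_lin] linear_compose[unfolded o_def, OF _ linear_axis])
  have G_inner: "G \<bullet> X = f X" for X
    using adjoint_works[OF f_lin, of X 1] by (simp add: G_def inner_commute)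
  have "adjoint_mat G \<bullet> X = G \<bullet> X" for X
  proof -
    have "adjoint_mat G \<bullet> X = f (adjoint_mat X)"
      using inner_adjoint_mat[of G "adjoint_mat X"] by (simp add: G_inner)
    also have "\<dots> = f X"
      by (simp add: f_def add.commute)
    finally show ?thesis
      by (simp add: G_inner)
  qed
  then have G_herm: "hermitian G"
    unfolding hermitian_def by (meson vector_eq_rdot)
  \<comment> \<open>The factor 1/2 makes the symmetrisation the identity on Hermitian
    matrices.\<close>
  have f_herm: "f X = D (axis k X)" if "hermitian X" for X
    using that by (simp add: f_def hermitian_def flip: scaleR_2)
  have "((\<lambda>s. complex_of_real (\<E> (shift_at \<rho> k (s *\<^sub>R X))))
          has_vector_derivative trace (G ** X)) (at 0)" if X: "hermitian X" for X
  proof -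
    let ?p = "\<lambda>s::real. \<rho> + s *\<^sub>R axis k X"
    \<comment> \<open>The whole line stays in the Hermitian subspace, so the derivative relative to
      that subspace yields a two-sided derivative in the real parameter.\<close>
    have "?p ` UNIV \<subseteq> hermitian_tuples"
      using \<rho> X by (auto simp: hermitian_tuples_def axis_def intro!: hermitian_add hermitian_scaleR hermitian_0)
    then have "(\<E> has_derivative D) (at (?p 0) within ?p ` UNIV)"
      using has_derivative_subset[OF D] by simp
    moreover have "(?p has_vector_derivative axis k X) (at 0)"
      by (auto intro!: derivative_eq_intros)
    ultimately have "((\<E> \<circ> ?p) has_vector_derivative D (axis k X)) (at 0)"
      by (rule vector_derivative_diff_chain_within[rotated])
    then have "((\<lambda>s. complex_of_real (\<E> (?p s))) has_vector_derivative of_real (D (axis k X))) (at 0)"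
      by (intro has_vector_derivative_of_real)
         (simp add: o_def has_real_derivative_iff_has_vector_derivative)
    then show ?thesis
      using X G_herm
      by (simp add: shift_at_axis linear_scale[OF linear_axis] trace_mult_hermitian G_inner f_herm)
  qed
  then have "is_hs_gradient \<E> \<rho> k G"
    using G_herm by (simp add: is_hs_gradient_def)
  then have "hs_gradient \<E> \<rho> k = G"
    unfolding hs_gradient_def by (blast intro: is_hs_gradient_unique)
  then show "hermitian (hs_gradient \<E> \<rho> k)"
    and "hermitian X \<Longrightarrow> D (axis k X) = hs_gradient \<E> \<rho> k \<bullet> X"
    using G_herm G_inner f_herm by simp_all
qed

section \<open>Rank-one operators and expectation values\<close>

text \<open>The polarised form of \<open>ketbra\<close>: with the two slots separated, the product
  rule applies.\<close>

definition outer :: "complex^'n \<Rightarrow> complex^'n \<Rightarrow> complex^'n^'n" where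
  "outer u v = (\<chi> i j. u $ i * cnj (v $ j))"

text \<open>Conjugation in the second slot is still linear over the reals, and finite dimension
  supplies boundedness.\<close>

lemma bounded_bilinear_outer:
  "bounded_bilinear (outer :: complex^'n \<Rightarrow> complex^'n \<Rightarrow> complex^'n^'n)"
  unfolding bilinear_conv_bounded_bilinear[symmetric] bilinear_def
  by (auto intro!: linearI simp: outer_def vec_eq_iff algebra_simps)

lemma ketbra_eq_outer: "ketbra v = outer v v"
  by (simp add: ketbra_def outer_def)

lemma adjoint_mat_outer: "adjoint_mat (outer u v) = outer v u"
  by (simp add: adjoint_mat_def outer_def vec_eq_iff)

lemma hermitian_ketbra: "hermitian (ketbra v)"
  by (simp add: hermitian_def ketbra_eq_outer adjoint_mat_outer)

lemma inner_outer: "G \<bullet> outer v u = (G *v u) \<bullet> v"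
  by (simp add: inner_vec_def outer_def matrix_vector_mult_def inner_complex_def
      sum_distrib_left sum_distrib_right Re_sum Im_sum algebra_simps flip: sum.distrib)

text \<open>Taking adjoints fixes \<open>G\<close> and exchanges the two rank-one terms, so both
  contribute equally; this is the source of the factor 2.\<close>

lemma inner_hermitian_outer_sum:
  assumes "hermitian G"
  shows "G \<bullet> (outer u v + outer v u) = 2 * ((G *v u) \<bullet> v)"
proof -
  have "G \<bullet> outer u v = G \<bullet> outer v u"
    using inner_adjoint_mat[of G "outer v u"] assms by (simp add: hermitian_def adjoint_mat_outer)
  then show ?thesis
    by (simp add: inner_add_right inner_outer)
qed

text \<open>Conjugation turns \<open>G\<close> into its adjoint, that is, into \<open>G\<close>
  again, so the expectation value is real; its real part is the library inner product.\<close>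

lemma braket_hermitian:
  assumes "hermitian G"
  shows "braket u (G *v u) = of_real (u \<bullet> (G *v u))"
proof -
  have Re: "Re (braket u v) = u \<bullet> v" for u v :: "complex^'a"
    by (simp add: braket_def inner_vec_def inner_complex_def Re_sum)
  have "cnj (braket u (G *v u)) = (\<Sum>i\<in>UNIV. \<Sum>j\<in>UNIV. cnj (u $ j) * (G $ j $ i * u $ i))"
    by (simp add: braket_def matrix_vector_mult_def sum_distrib_left cnj_sum
        hermitian_nth[OF assms, symmetric] mult_ac)
  also have "\<dots> = braket u (G *v u)"
    by (subst sum.swap) (simp add: braket_def matrix_vector_mult_def sum_distrib_left)
  finally show ?thesis
    by (simp add: complex_eq_iff Re)
qed

text \<open>The left-hand side is minus the variance of \<open>H\<close> in the state
  \<open>u\<close>.\<close>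

lemma inner_nite_direction_nonpos:
  assumes H: "hermitian H" and u: "norm u = 1"
  shows "(H *v u) \<bullet> (- ((H - mat (braket u (H *v u))) *v u)) \<le> 0"
proof -
  let ?r = "u \<bullet> (H *v u)"
  \<comment> \<open>Because the expectation value is real, the complex scalar matrix acts as a real
    scaling, and the computation stays within the real inner product.\<close>
  have "mat (complex_of_real ?r) *v u = ?r *\<^sub>R u"
    by (simp add: vec_eq_iff matrix_vector_mult_def mat_def if_distrib[of "\<lambda>x. x * _"]
        scaleR_conv_of_real[where 'a = complex] cong: if_cong)
  then have "(H *v u) \<bullet> (- ((H - mat (braket u (H *v u))) *v u)) = ?r * ?r - (H *v u) \<bullet> (H *v u)"
    by (simp add: braket_hermitian[OF H] matrix_vector_mult_diff_rdistrib inner_diff_right inner_commute)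
  moreover have "?r * ?r \<le> (H *v u) \<bullet> (H *v u)"
    using Cauchy_Schwarz_ineq[of u "H *v u"] u by (simp add: power2_eq_square norm_eq_1)
  ultimately show ?thesis
    by simp
qed

theorem mainTheorem3:
  fixes E :: "complex^'n^'k \<Rightarrow> real"
    and \<E> :: "complex^'n^'n^'k \<Rightarrow> real"
    and \<phi> :: "real \<Rightarrow> complex^'n^'k"
    and T :: "real set"
  assumes E_diff: "E differentiable_on pure_states"
    and E_phase: "\<And>\<psi> c. \<psi> \<in> pure_states \<Longrightarrow> (\<And>k. cmod (c k) = 1) \<Longrightarrow>
                    E (\<chi> k. c k *s (\<psi> $ k)) = E \<psi>"
    and \<E>_diff: "\<E> differentiable_on hermitian_tuples"
    and E_eq: "\<And>\<psi>. \<psi> \<in> pure_states \<Longrightarrow> E \<psi> = \<E> (density_tuple \<psi>)"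
    and T_interval: "is_interval T"
    and unit: "\<And>t. t \<in> T \<Longrightarrow> \<phi> t \<in> pure_states"
    and nite: "solves_nite \<E> T \<phi>"
  shows "antimono_on T (\<lambda>t. E (\<phi> t))"
proof -
  have deriv: "\<exists>e\<le>0. ((\<lambda>s. E (\<phi> s)) has_vector_derivative e) (at t within T)" if t: "t \<in> T" for t
  proof -
    define H where "H = nite_hamiltonian \<E> (\<phi> t)"
    define v where "v k = - ((H k - mat (braket (\<phi> t $ k) (H k *v (\<phi> t $ k)))) *v (\<phi> t $ k))" for k
    define R where "R k = outer (\<phi> t $ k) (v k) + outer (v k) (\<phi> t $ k)" for k
    have range: "density_tuple \<psi> \<in> hermitian_tuples" for \<psi> :: "complex^'n^'k"
      by (simp add: hermitian_tuples_def density_tuple_def hermitian_ketbra)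
    obtain D where D: "(\<E> has_derivative D) (at (density_tuple (\<phi> t)) within hermitian_tuples)"
      using \<E>_diff range unfolding differentiable_on_def differentiable_def by blast
    have H_herm: "hermitian (H k)" for k
      unfolding H_def nite_hamiltonian_def by (rule hs_gradient_represents_derivative(1)[OF D range])
    have R_herm: "hermitian (R k)" for k
      using hermitian_add_adjoint[of "outer (\<phi> t $ k) (v k)"] by (simp add: R_def adjoint_mat_outer)
    have DH: "D (axis k (R k)) = H k \<bullet> R k" for k
      unfolding H_def nite_hamiltonian_def by (rule hs_gradient_represents_derivative(2)[OF D range R_herm])
    have "((\<lambda>s. \<phi> s $ k) has_vector_derivative v k) (at t within T)" for k
      using nite t by (simp add: solves_nite_def v_def H_def)
    then have "((\<lambda>s. outer (\<phi> s $ k) (\<phi> s $ k)) has_vector_derivative R k) (at t within T)" for k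
      unfolding R_def by (intro bounded_bilinear.has_vector_derivative[OF bounded_bilinear_outer])
    then have "((\<lambda>s. density_tuple (\<phi> s)) has_vector_derivative (\<chi> k. R k)) (at t within T)"
      by - (rule has_vector_derivative_vec, simp add: density_tuple_def ketbra_eq_outer)
    \<comment> \<open>The chain rule asks for the outer derivative relative to the image of the
      curve, which consists of Hermitian tuples.\<close>
    moreover have "(\<E> has_derivative D)
        (at (density_tuple (\<phi> t)) within (\<lambda>s. density_tuple (\<phi> s)) ` T)"
      by (rule has_derivative_subset[OF D]) (use range in auto)
    ultimately have "(\<E> \<circ> (\<lambda>s. density_tuple (\<phi> s)) has_vector_derivative D (\<chi> k. R k)) (at t within T)"
      by (rule vector_derivative_diff_chain_within)
    \<comment> \<open>\<open>E\<close> and \<open>\<E>\<close> are identified at unit vectors, hence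
      along the curve for times in \<open>T\<close>, which suffices for a derivative within
      \<open>T\<close>.\<close>
    then have "((\<lambda>s. E (\<phi> s)) has_vector_derivative D (\<chi> k. R k)) (at t within T)"
      by (rule has_vector_derivative_transform[OF t, rotated]) (simp add: E_eq unit)
    moreover have "D (\<chi> k. R k) \<le> 0"
    proof -
      \<comment> \<open>Splitting the joint velocity into single-argument directions lets linearity
        of \<open>D\<close> bring in the partial gradients \<open>H k\<close>.\<close>
      have "(\<chi> k. R k) = (\<Sum>k\<in>UNIV. axis k (R k))"
        by (simp add: vec_eq_iff axis_def sum_component)
      then have "D (\<chi> k. R k) = (\<Sum>k\<in>UNIV. H k \<bullet> R k)"
        by (simp add: linear_sum[OF has_derivative_linear[OF D]] DH)
      also have "\<dots> = (\<Sum>k\<in>UNIV. 2 * ((H k *v (\<phi> t $ k)) \<bullet> v k))"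
        by (simp add: R_def inner_hermitian_outer_sum[OF H_herm])
      also have "\<dots> \<le> 0"
        using inner_nite_direction_nonpos[OF H_herm] unit[OF t]
        by (intro sum_nonpos) (simp add: v_def pure_states_def mult_le_0_iff)
      finally show ?thesis .
    qed
    ultimately show ?thesis
      by blast
  qed
  show ?thesis
  proof (rule monotone_onI)
    fix a b assume ab: "a \<in> T" "b \<in> T" "a \<le> b"
    have sub: "{a..b} \<subseteq> T"
      by (meson T_interval ab(1,2) atLeastAtMost_iff mem_is_interval_1_I subsetI)
    from deriv obtain e where e: "\<And>t. t \<in> T \<Longrightarrow> e t \<le> 0"
      "\<And>t. t \<in> T \<Longrightarrow> ((\<lambda>s. E (\<phi> s)) has_vector_derivative e t) (at t within T)"
      by metis
    \<comment> \<open>Mean value theorem on \<open>{a..b}\<close>, which lies in \<open>T\<close>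
      because \<open>T\<close> is an interval; derivatives within \<open>T\<close> restrict to it,
      one-sided ones at endpoints included.\<close>
    have "\<exists>x\<in>{a..b}. E (\<phi> b) - E (\<phi> a) = (b - a) *\<^sub>R e x"
    proof (rule mvt_very_simple[OF ab(3)])
      fix x assume "a \<le> x" "x \<le> b"
      then have "x \<in> T"
        using sub by auto
      then show "((\<lambda>s. E (\<phi> s)) has_derivative (\<lambda>h. h *\<^sub>R e x)) (at x within {a..b})"
        using e(2) has_derivative_subset[OF _ sub] unfolding has_vector_derivative_def by blast
    qed
    then obtain x where x: "x \<in> {a..b}" "E (\<phi> b) - E (\<phi> a) = (b - a) *\<^sub>R e x"
      by blast
    moreover have "(b - a) * e x \<le> 0"
      using e(1) sub x(1) ab(3) by (intro mult_nonneg_nonpos) auto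
    ultimately show "E (\<phi> b) \<le> E (\<phi> a)"
      by simp
  qed
qed

end
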